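(* For any positive integers $\alpha,m,n,r$, the expression $$\sum_{k=0}^{n-1}(-1)^{k}\,[k(k+1)]^r_{q^2}\,[2k+1]\,q^{(n-1-k)(2\alpha m+1)}\,w_k^{(\alpha)}(x;q^2)^m$$ is divisible, in the ring $\mathbb{Z}[q,q^{-1}][x]$, by $$\prod_{\substack{d\mid n \\ d>1\text{ odd}}}\Phi_d(q)\cdot\prod_{\substack{d\mid n \\ d>1\text{ even}}}\Phi_d(q^2).$$
   Context: Here $q$ and $x$ are indeterminates. For an integer $N$, $[N]=[N]_q=\frac{1-q^N}{1-q}$ is the $q$-integer, and $[N]_{q^2}=\frac{1-q^{2N}}{1-q^2}$ is the same expression with $q$ replaced by $q^2$; $[k(k+1)]^r_{q^2}$ is the $r$-th power of $[k(k+1)]_{q^2}$. $\Phi_d(q)=\prod_{1\le k\le d,\ \gcd(k,d)=1}(q-e^{2\pi i k/d})\in\mathbb{Z}[q]$ is the $d$-th cyclotomic polynomial. For nonnegative integers $N$ and integers $k$, $\left[\begin{matrix} N \\ k \end{matrix}\right]=\frac{\prod_{1\le j\le k}[N-j+1]}{\prod_{1\le j\le k}[j]}$ is the $q$-binomial coefficient, equal to $1$ if $k=0$ and to $0$ if $k<0$ or $k>N$. For a nonnegative integer $k$ and a positive integer $\alpha$, $$w_k^{(\alpha)}(x;q)=\sum_{j=1}^{k}q^{\alpha\left(\binom{j+1}{2}-(k+1)(j-1)\right)}\left(\left[\begin{matrix} k-1 \\ j-1 \end{matrix}\right]\left[\begin{matrix} k+j \\ j \end{matrix}\right]-\left[\begin{matrix}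 k \\ j \end{matrix}\right]\left[\begin{matrix} k+j \\ j-1 \end{matrix}\right]\right)^{\alpha}x^{j-1}\in\mathbb{Z}[q,q^{-1}][x],$$ with $w_0^{(\alpha)}(x;q)=0$ (empty sum); $w_k^{(\alpha)}(x;q^2)$ is obtained from it by replacing $q$ by $q^2$ throughout. *)

theory Defs
  imports
    Complex_Main
    "HOL-Computational_Algebra.Polynomial_Factorial"
    "HOL-Number_Theory.Totient"
begin

section \<open>The ring of Laurent polynomials inside the field of rational functions\<close>

text \<open>
  All computations take place in \<open>\<rat>(q)[x]\<close>, rendered as polynomials in \<open>x\<close> over the
  fraction field of \<open>\<int>[q]\<close>, so that the quotients defining the \<open>q\<close>-analogues are
  genuine quotients. The rings \<open>\<int>[q, q\<^sup>-\<^sup>1]\<close> and \<open>\<int>[q, q\<^sup>-\<^sup>1][x]\<close> are subrings.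
\<close>

type_synonym ratfun = "int poly fract"

definition qq :: ratfun where
  "qq = to_fract [:0, 1:]"

definition laurent_ring :: "ratfun set" where
  "laurent_ring = {to_fract p / qq ^ i | p i. True}"

definition laurent_poly_ring :: "ratfun poly set" where
  "laurent_poly_ring = {f. \<forall>i. coeff f i \<in> laurent_ring}"

definition dvd_in :: "'a::comm_ring_1 set \<Rightarrow> 'a \<Rightarrow> 'a \<Rightarrow> bool" where
  "dvd_in R a b \<longleftrightarrow> a \<in> R \<and> b \<in> R \<and> (\<exists>c\<in>R. b = a * c)"


section \<open>q-analogues\<close>

text \<open>
  The base \<open>q\<close> is a parameter ranging over a field, so that replacing \<open>q\<close> by \<open>q\<^sup>2\<close> is
  substitution for this parameter. The formulas are meaningful whenever \<open>q\<close> is nonzero and not a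
  root of unity, in particular at \<^const>\<open>qq\<close> and its square.
\<close>

definition qint :: "'a::field \<Rightarrow> int \<Rightarrow> 'a" where
  "qint q N = (1 - q powi N) / (1 - q)"

definition qbinom :: "'a::field \<Rightarrow> nat \<Rightarrow> int \<Rightarrow> 'a" where
  "qbinom q N k =
     (if k < 0 \<or> k > int N then 0
      else (\<Prod>j=1..k. qint q (int N - j + 1)) / (\<Prod>j=1..k. qint q j))"

definition w :: "nat \<Rightarrow> nat \<Rightarrow> 'a::field \<Rightarrow> 'a poly" where
  "w \<alpha> k q = (\<Sum>j=1..k. monom
     (q powi (int \<alpha> * (int ((j + 1) choose 2) - (int k + 1) * (int j - 1))) *
      (qbinom q (k - 1) (int j - 1) * qbinom q (k + j) (int j) -
       qbinom q k (int j) * qbinom q (k + j) (int j - 1)) ^ \<alpha>)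
     (j - 1))"


section \<open>Cyclotomic polynomials\<close>

definition complex_cyclotomic :: "nat \<Rightarrow> complex poly" where
  "complex_cyclotomic d = (\<Prod>k\<in>totatives d. [:- cis (2 * pi * real k / real d), 1:])"

definition cyclotomic :: "nat \<Rightarrow> int poly" where
  "cyclotomic d = (THE p. map_poly of_int p = complex_cyclotomic d)"

definition cyclotomic_at :: "nat \<Rightarrow> 'a::comm_ring_1 \<Rightarrow> 'a" where
  "cyclotomic_at d t = poly (map_poly of_int (cyclotomic d)) t"

text \<open>The description defining \<^const>\<open>cyclotomic\<close> is proper: the product has integer coefficients.\<close>

abbreviation cpoly :: "int poly \<Rightarrow> complex poly" where
  "cpoly \<equiv> map_poly of_int"

lemma cpoly_mult: "cpoly (p * q) = cpoly p * cpoly q"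
  by (rule poly_eqI) (simp add: coeff_map_poly coeff_mult)

lemma cpoly_add: "cpoly (p + q) = cpoly p + cpoly q"
  by (rule poly_eqI) (simp add: coeff_map_poly)

lemma cpoly_prod: "cpoly (\<Prod>i\<in>A. f i) = (\<Prod>i\<in>A. cpoly (f i))"
  by (induction A rule: infinite_finite_induct) (simp_all add: cpoly_mult)

lemma cpoly_inj: "cpoly p = cpoly q \<Longrightarrow> p = q"
  by (simp add: poly_eq_iff coeff_map_poly)

lemma degree_cpoly: "degree (cpoly p) = degree p"
  by (rule degree_map_poly) auto

lemma integral_quotient:
  assumes P: "cpoly P = cpoly M * C" and M: "lead_coeff M = 1"
  shows "\<exists>D. cpoly D = C"
proof -
  have M0: "M \<noteq> 0" using M by auto
  obtain Q R where QR: "pseudo_divmod P M = (Q, R)" by fastforce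
  have eq: "P = M * Q + R" and R: "R = 0 \<or> degree R < degree M"
    using pseudo_divmod[OF M0 QR] M by auto
  have "cpoly M * (C - cpoly Q) = cpoly R"
    using P by (simp add: eq cpoly_mult cpoly_add algebra_simps)
  moreover have "C - cpoly Q = 0"
  proof (rule ccontr)
    assume *: "C - cpoly Q \<noteq> 0"
    have M1: "cpoly M \<noteq> 0" using M0 cpoly_inj[of M 0] by auto
    have "degree (cpoly M * (C - cpoly Q)) = degree M + degree (C - cpoly Q)"
      using * M1 by (simp add: degree_mult_eq degree_cpoly)
    moreover have "cpoly M * (C - cpoly Q) \<noteq> 0" using * M1 by simp
    ultimately show False
      using R \<open>cpoly M * (C - cpoly Q) = cpoly R\<close> degree_cpoly[of R] by auto
  qed
  ultimately show ?thesis by (intro exI[of _ Q]) simp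
qed

lemma prod_linear_roots_of_unity:
  assumes "n > 0"
  shows "(\<Prod>k\<in>{0<..n}. [:- cis (2 * pi * real k / real n), 1:]) = monom 1 n - (1 :: complex poly)"
    (is "?L = ?R")
proof -
  let ?c = "\<lambda>k. cis (2 * pi * real k / real n)"
  have bij: "bij_betw ?c {..<n} {z. z ^ n = 1}"
    using bij_betw_roots_unity[OF assms] by simp
  have shift: "?L = (\<Prod>k<n. [:- ?c k, 1:])"
  proof -
    have "?c n = ?c 0" using assms by (simp add: complex_eq_iff)
    moreover have "{0<..n} = insert n {0<..<n}" "{..<n} = insert 0 {0<..<n}"
      using assms by auto
    ultimately show ?thesis by simp
  qed
  also have "\<dots> = (\<Prod>z\<in>{z. z ^ n = 1}. [:- z, 1:])"
    by (rule prod.reindex_bij_betw[OF bij])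
  also have "\<dots> = ?R"
  proof (rule ccontr)
    let ?S = "{z::complex. z ^ n = 1}"
    let ?P = "\<Prod>z\<in>?S. [:- z, 1:]"
    assume ne: "?P \<noteq> ?R"
    have fin: "finite ?S" and card: "card ?S = n"
      using finite_roots_unity[of n] card_roots_unity_eq[OF assms] assms by auto
    have degP: "degree ?P = n" by (subst degree_prod_eq_sum_degree) (use card in auto)
    have lcP: "lead_coeff ?P = 1" by (simp add: lead_coeff_prod)
    have degR: "degree ?R \<le> n" by (intro degree_diff_le) (auto simp: degree_monom_le)
    have "coeff (?P - ?R) n = 0" using lcP degP assms by simp
    moreover have "degree (?P - ?R) \<le> n" by (rule degree_diff_le) (use degP degR in auto)
    ultimately have "degree (?P - ?R) < n"
      using ne by (metis eq_iff_diff_eq_0 leading_coeff_0_iff order_le_less)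
    moreover have "card ?S \<le> card {z. poly (?P - ?R) z = 0}"
      using ne fin by (intro card_mono poly_roots_finite)
        (auto simp: poly_prod poly_monom intro!: prod_zero)
    moreover have "card {z. poly (?P - ?R) z = 0} \<le> degree (?P - ?R)"
      using ne by (intro card_poly_roots_bound) auto
    ultimately show False using card by simp
  qed
  finally show ?thesis .
qed

lemma prod_complex_cyclotomic:
  assumes "n > 0"
  shows "(\<Prod>d | d dvd n. complex_cyclotomic d) = monom 1 n - 1"
proof -
  let ?f = "\<lambda>k. [:- cis (2 * pi * real k / real n), 1:]"
  have "monom 1 n - 1 = (\<Prod>k\<in>{0<..n}. ?f k)"
    using prod_linear_roots_of_unity[OF assms] by simp
  also have "\<dots> = (\<Prod>d | d dvd n. \<Prod>k | k \<in> {0<..n} \<and> gcd k n = d. ?f k)"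
    using assms by (subst prod.group[symmetric, where g = "\<lambda>k. gcd k n" and T = "{d. d dvd n}"]) auto
  also have "\<dots> = (\<Prod>d | d dvd n. complex_cyclotomic (n div d))"
  proof (rule prod.cong[OF refl])
    fix d assume "d \<in> {d. d dvd n}"
    then have d: "d dvd n" by simp
    then obtain e where e: "n = d * e" by auto
    have "(\<Prod>k | k \<in> {0<..n} \<and> gcd k n = d. ?f k) = (\<Prod>k\<in>totatives (n div d). ?f (k * d))"
      using prod.reindex_bij_betw[OF bij_betw_totatives_gcd_eq[OF d assms], of ?f] by simp
    also have "\<dots> = complex_cyclotomic (n div d)"
      using e assms by (auto simp: complex_cyclotomic_def mult.assoc intro!: prod.cong)
    finally show "(\<Prod>k | k \<in> {0<..n} \<and> gcd k n = d. ?f k) = complex_cyclotomic (n div d)" .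
  qed
  also have "\<dots> = (\<Prod>d | d dvd n. complex_cyclotomic d)"
    by (rule prod.reindex_bij_witness[of _ "\<lambda>d. n div d" "\<lambda>d. n div d"]) (use assms in auto)
  finally show ?thesis by simp
qed

lemma lead_coeff_complex_cyclotomic: "lead_coeff (complex_cyclotomic d) = 1"
  by (simp add: complex_cyclotomic_def lead_coeff_prod)

lemma complex_cyclotomic_integral: "\<exists>p. cpoly p = complex_cyclotomic d"
proof (induction d rule: less_induct)
  case (less n)
  show ?case
  proof (cases "n = 0")
    case True
    then show ?thesis by (intro exI[of _ 1]) (simp add: complex_cyclotomic_def)
  next
    case False
    define D where "D = {d. d dvd n \<and> d \<noteq> n}"
    have split: "{d. d dvd n} = insert n D" "n \<notin> D" "finite D"
      using False by (auto simp: D_def)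
    have "\<exists>p. cpoly p = complex_cyclotomic d" if "d \<in> D" for d
      using that less False by (auto simp: D_def dest: dvd_imp_le intro!: less)
    then obtain f where f: "\<And>d. d \<in> D \<Longrightarrow> cpoly (f d) = complex_cyclotomic d" by metis
    define M where "M = (\<Prod>d\<in>D. f d)"
    have cM: "cpoly M = (\<Prod>d\<in>D. complex_cyclotomic d)"
      by (simp add: M_def cpoly_prod f)
    have "lead_coeff (cpoly M) = 1"
      by (simp only: cM lead_coeff_prod lead_coeff_complex_cyclotomic) simp
    then have M: "lead_coeff M = 1" by (simp add: degree_cpoly coeff_map_poly)
    have "cpoly (monom 1 n - 1) = cpoly M * complex_cyclotomic n"
    proof -
      have "cpoly (monom 1 n - 1) = monom 1 n - 1"
        by (rule poly_eqI) (simp add: coeff_map_poly)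
      also have "\<dots> = cpoly M * complex_cyclotomic n"
        using prod_complex_cyclotomic[of n] False split by (simp add: cM mult.commute)
      finally show ?thesis .
    qed
    then show ?thesis by (rule integral_quotient[OF _ M])
  qed
qed

lemma of_int_cyclotomic: "map_poly of_int (cyclotomic d) = complex_cyclotomic d"
  unfolding cyclotomic_def
  by (rule theI') (use complex_cyclotomic_integral cpoly_inj in metis)

end

theory Submission
  imports Defs "HOL-Computational_Algebra.Fundamental_Theorem_Algebra"
begin

text \<open>
  The divisor is monic and squarefree, so each coefficient of the sum only has to vanish at the
  complex roots \<open>z\<close> of the divisor. For such \<open>z\<close> there is a divisor \<open>d > 1\<close> of \<open>n\<close> such that \<open>q = z\<^sup>2\<close>
  is a primitive \<open>d\<close>-th root of unity and \<open>z\<^sup>d = -(-1)\<^sup>d\<close>. On each block \<open>{ad, \<dots>, ad + d - 1}\<close>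
  reverse the order, \<open>k + k' + 1 = (2a + 1)d\<close>. The coefficients
  of \<open>[k][k+1] w\<^sub>k\<close> are built from \<open>[k choose j][k+j choose j]\<close>, whose factors
  \<open>(1 - q\<^bsup>k-i+1\<^esup>)(1 - q\<^bsup>k+i\<^esup>)\<close> are invariant under \<open>k \<mapsto> -1-k\<close> up to a power of \<open>q\<close>; hence
  \<open>q\<^bsup>-\<alpha>k\<^esup> w\<^sub>k\<close> is invariant under \<open>k \<mapsto> k'\<close> whenever \<open>[k][k+1]\<close> does not vanish, while otherwise the
  summand is zero because \<open>r > 0\<close>. The remaining factors change sign, so the sum equals its negative.
\<close>

section \<open>Gaussian binomial coefficients\<close>

text \<open>The q-Pascal recurrence replaces the quotient in \<open>qbinom\<close>, so the value
  exists at roots of unity, where that quotient may be 0/0, and it commutes with specialization of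
  q.\<close>

fun gauss :: "'a::comm_ring_1 \<Rightarrow> nat \<Rightarrow> nat \<Rightarrow> 'a" where
  "gauss q n 0 = 1"
| "gauss q 0 (Suc k) = 0"
| "gauss q (Suc n) (Suc k) = gauss q n k + q ^ Suc k * gauss q n (Suc k)"

lemma gauss_eq_0: "k > n \<Longrightarrow> gauss q n k = 0"
  by (induction q n k rule: gauss.induct) auto

text \<open>In the application \<open>g0\<close> and \<open>g1\<close> are the entries of row n at k
  and k+1, \<open>a\<close> is q^(k+1) and \<open>p\<close> is q^(n-k). Then
  \<open>g0 + a * g1\<close> is the Pascal entry of row n+1, and \<open>a * p\<close> is
  q^(n+1).\<close>

lemma absorb_step:
  fixes a p :: "'a::comm_ring_1"
  assumes "(1 - a) * g1 = (1 - p) * g0"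
  shows "(1 - a) * (g0 + a * g1) = (1 - a * p) * g0"
    and "(1 - p) * (g0 + a * g1) = (1 - a * p) * g1"
proof -
  have "(1 - a) * (g0 + a * g1) = (1 - a) * g0 + a * ((1 - a) * g1)"
    "(1 - p) * (g0 + a * g1) = (1 - p) * g0 + a * (1 - p) * g1"
    by (simp_all add: algebra_simps)
  then show "(1 - a) * (g0 + a * g1) = (1 - a * p) * g0" "(1 - p) * (g0 + a * g1) = (1 - a * p) * g1"
    by (simp_all add: assms flip: assms, simp_all add: assms algebra_simps)
qed

lemma power_powi_diff:
  fixes q :: "'a::field"
  assumes "q \<noteq> 0"
  shows "q ^ Suc k * q powi (int n - int k) = q ^ Suc n"
  using assms by (simp add: power_int_diff field_simps)

text \<open>The cross-multiplied ratio of neighbours stays valid where a factor vanishes. In row n+1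
  both sides equal (1 - q^(n+1)) times \<open>gauss q n k\<close>: the left one by the induction
  hypothesis at k, the right one by that at k-1 (directly if k = 0). The integer power covers k >
  n.\<close>

lemma gauss_shift:
  fixes q :: "'a::field"
  assumes "q \<noteq> 0"
  shows "(1 - q ^ Suc k) * gauss q n (Suc k) = (1 - q powi (int n - int k)) * gauss q n k"
proof (induction n arbitrary: k)
  case 0
  then show ?case by (cases k) auto
next
  case (Suc n)
  have absorb: "(1 - q ^ Suc k) * gauss q (Suc n) (Suc k) = (1 - q ^ Suc n) * gauss q n k"
    using absorb_step(1)[OF Suc[of k]] unfolding power_powi_diff[OF assms] by simp
  show ?case
  proof (cases k)
    case 0
    then show ?thesis using absorb by (simp del: of_nat_Suc power_Suc)
  next
    case (Suc l)
    have "(1 - q powi (int n - int l)) * gauss q (Suc n) (Suc l) = (1 - q ^ Suc n) * gauss q n (Suc l)"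
      using absorb_step(2)[OF Suc.IH[of l]] unfolding power_powi_diff[OF assms] by simp
    then show ?thesis using absorb Suc by simp
  qed
qed

lemma gauss_absorb:
  fixes q :: "'a::field"
  assumes "q \<noteq> 0"
  shows "(1 - q ^ Suc k) * gauss q (Suc n) (Suc k) = (1 - q ^ Suc n) * gauss q n k"
  using absorb_step(1)[OF gauss_shift[OF assms, of k n]] unfolding power_powi_diff[OF assms] by simp

lemma gauss_upper:
  fixes q :: "'a::field"
  assumes "q \<noteq> 0"
  shows "(1 - q powi (int (Suc n) - int k)) * gauss q (Suc n) k = (1 - q ^ Suc n) * gauss q n k"
proof (cases k)
  case 0
  then show ?thesis by (simp del: of_nat_Suc power_Suc)
next
  case (Suc l)
  show ?thesis
    using absorb_step(2)[OF gauss_shift[OF assms, of l n]]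
    unfolding power_powi_diff[OF assms] Suc by simp
qed

declare gauss.simps(3)[simp del]

lemma qint_of_nat: "qint q (int n) = (1 - q ^ n) / (1 - q)"
  by (simp add: qint_def)

lemma qbinom_eq_gauss:
  fixes q :: "'a::field"
  assumes "q \<noteq> 0" and nru: "\<And>i. i > 0 \<Longrightarrow> q ^ i \<noteq> 1"
  shows "qbinom q n (int k) = gauss q n k"
proof -
  have q1: "1 - q \<noteq> 0" using nru[of 1] by simp
  have Suc_set: "{1..int (Suc k)} = insert (int k + 1) {1..int k}" for k
    by auto
  have eq: "(\<Prod>j=1..int k. qint q (int n - j + 1)) = (\<Prod>j=1..int k. qint q j) * gauss q n k" for k
  proof (induction k)
    case (Suc k)
    have "qint q (int n - int k) * gauss q n k = qint q (int k + 1) * gauss q n (Suc k)"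
      using gauss_shift[OF assms(1), of k n] q1
      by (simp add: qint_def power_int_add_1' assms(1))
    then show ?case
      unfolding Suc_set using Suc by (simp add: algebra_simps)
  qed simp
  have "qint q j \<noteq> 0" if "j \<in> {1..int k}" for j
    using that nru[of "nat j"] q1 by (simp add: qint_def power_int_def)
  then have "(\<Prod>j=1..int k. qint q j) \<noteq> 0" by simp
  then show ?thesis
    by (simp add: qbinom_def eq gauss_eq_0)
qed

section \<open>Products of Gaussian binomials and the coefficients of \<open>w\<close>\<close>

definition central :: "'a::comm_ring_1 \<Rightarrow> nat \<Rightarrow> nat \<Rightarrow> 'a" where
  "central q k j = gauss q k j * gauss q (k + j) j"

text \<open>Only the factors with exponents k-j and k+j+1 involve k, and substituting -1-k for k
  turns each exponent into the negative of the other. This drives the reflection.\<close>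

lemma central_Suc:
  fixes q :: "'a::field"
  assumes "q \<noteq> 0"
  shows "(1 - q ^ Suc j)\<^sup>2 * central q k (Suc j) =
    (1 - q powi (int k - int j)) * (1 - q ^ (k + Suc j)) * central q k j"
proof -
  have "(1 - q ^ Suc j)\<^sup>2 * central q k (Suc j) =
    ((1 - q ^ Suc j) * gauss q k (Suc j)) * ((1 - q ^ Suc j) * gauss q (Suc (k + j)) (Suc j))"
    by (simp only: central_def power2_eq_square add_Suc_right mult_ac)
  also have "\<dots> = ((1 - q powi (int k - int j)) * gauss q k j) * ((1 - q ^ Suc (k + j)) * gauss q (k + j) j)"
    unfolding gauss_shift[OF assms, of j k] gauss_absorb[OF assms, of j "k + j"] ..
  finally show ?thesis by (simp add: central_def mult_ac)
qed

text \<open>For q = 1 and j, k > 0 this is (1/j) (k-1 choose j-1) (k+j choose j-1), the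
  Kirkman-Cayley number of dissections of a (k+2)-gon by j-1 diagonals. The difference form avoids
  the division.\<close>

definition narayana :: "'a::comm_ring_1 \<Rightarrow> nat \<Rightarrow> nat \<Rightarrow> 'a" where
  "narayana q k j = gauss q (k - 1) (j - 1) * gauss q (k + j) j - gauss q k j * gauss q (k + j) (j - 1)"

text \<open>Absorption expresses both products through \<open>central\<close>. The relation
  determines \<open>narayana\<close> only where q^k and q^(k+1) differ from 1.\<close>

lemma narayana_central:
  fixes q :: "'a::field"
  assumes "q \<noteq> 0" "k > 0" "j > 0"
  shows "(1 - q ^ k) * (1 - q ^ (k + 1)) * narayana q k j = (1 - q) * q ^ k * (1 - q ^ j) * central q k j"
proof -
  obtain l i where li: "k = Suc l" "j = Suc i" using assms by (cases k; cases j) auto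
  have a: "(1 - q ^ k) * gauss q (k - 1) (j - 1) = (1 - q ^ j) * gauss q k j"
    using gauss_absorb[OF assms(1), of i l] li by simp
  have e: "int (k + j) - int i = int (k + 1)"
    using li by simp
  have b: "(1 - q ^ (k + 1)) * gauss q (k + j) (j - 1) = (1 - q ^ j) * gauss q (k + j) j"
    using gauss_shift[OF assms(1), of i "k + j", unfolded e power_int_of_nat] li(2) by simp
  \<comment> \<open>The two absorption relations turn the left side into (1-z) g3 g2 ((1-y) -
    (1-x)), and x - y = (1-q) x.\<close>
  have "(1 - x) * (1 - y) * (g1 * g2 - g3 * g4) = (y' - q) * x * (1 - z) * (g3 * g2)"
    if "(1 - x) * g1 = (1 - z) * g3" "(1 - y) * g4 = (1 - z) * g2" "y = q * x" "y' = 1"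
    for x y z g1 g2 g3 g4 y' :: 'a
    using that by algebra
  from this[OF a b] show ?thesis
    by (simp add: narayana_def central_def)
qed


section \<open>Reflection at roots of unity\<close>

definition primitive_root :: "nat \<Rightarrow> 'a::field \<Rightarrow> bool" where
  "primitive_root d q \<longleftrightarrow> d > 0 \<and> (\<forall>i. q ^ i = 1 \<longleftrightarrow> d dvd i)"

lemma primitive_root_nonzero: "primitive_root d q \<Longrightarrow> q \<noteq> 0"
  by (metis primitive_root_def dvd_refl power_0_left zero_neq_one neq0_conv)

lemma primitive_root_power_int:
  assumes "primitive_root d q" "int d dvd i"
  shows "q powi i = 1"
proof -
  have "q ^ d = 1" using assms(1) by (simp add: primitive_root_def)
  with assms(2) show ?thesis by (auto simp: power_int_mult)
qed

lemma primitive_root_power_cong: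
  assumes "primitive_root d q" "[i = j] (mod d)"
  shows "q ^ i = q ^ j"
proof -
  have "q ^ i = q ^ (i mod d)" for i
  proof -
    have "q ^ i = q ^ (d * (i div d)) * q ^ (i mod d)"
      by (simp flip: power_add)
    then show ?thesis using assms(1) by (simp add: primitive_root_def)
  qed
  then show ?thesis using assms(2) unfolding cong_def by metis
qed

text \<open>
  For \<open>d dvd j\<close> the coefficient depends on \<open>n\<close> only through \<open>n div d\<close>. This weak form of
  \<open>q\<close>-Lucas suffices to start the induction in \<open>central_reflect\<close> again at the indices \<open>j\<close> where
  \<open>1 - q\<^sup>j\<close> vanishes.
\<close>

lemma gauss_block_Suc:
  assumes "primitive_root d q" "d dvd j" "\<not> d dvd Suc n"
  shows "gauss q (Suc n) j = gauss q n j"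
proof -
  have q: "q \<noteq> 0" using assms by (rule_tac primitive_root_nonzero)
  have j: "q ^ j = 1" and n: "q ^ Suc n \<noteq> 1"
    using assms unfolding primitive_root_def by blast+
  \<comment> \<open>Since q^j = 1, both coefficients in \<open>gauss_upper\<close> equal 1 -
    q^(n+1), which is nonzero and cancels.\<close>
  have "q powi (int (Suc n) - int j) = q ^ Suc n"
    using q j by (subst power_int_diff) (simp_all del: of_nat_Suc power_Suc)
  then show ?thesis using gauss_upper[OF q, of n j] n by (simp del: power_Suc of_nat_Suc)
qed

lemma gauss_block:
  assumes "primitive_root d q" "d dvd j" "b < d"
  shows "gauss q (a * d + b) j = gauss q (a * d) j"
  using assms(3)
proof (induction b)
  case (Suc b)
  have "\<not> d dvd Suc b" using Suc.prems by (auto dest: dvd_imp_le)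
  then have "\<not> d dvd Suc (a * d + b)"
    by (metis add_Suc_right dvd_add_right_iff dvd_triv_right)
  then show ?case using gauss_block_Suc[OF assms(1,2)] Suc by simp
qed simp

lemma central_block:
  assumes "primitive_root d q" "d dvd j" "b < d"
  shows "central q (a * d + b) j = central q (a * d) j"
proof -
  \<comment> \<open>As d divides j, adding j to the row index keeps its offset b within the
    block.\<close>
  obtain l where "j = l * d" using assms(2) by (metis dvd_def mult.commute)
  then have "a * d + b + j = (a + l) * d + b" "a * d + j = (a + l) * d"
    by (simp_all add: algebra_simps)
  then show ?thesis by (simp only: central_def gauss_block[OF assms])
qed

section \<open>Reversal of a block of d consecutive indices\<close>

definition reflect :: "nat \<Rightarrow> nat \<Rightarrow> nat" where
  "reflect d k = k div d * d + (d - 1 - k mod d)"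

lemma reflect_sum: "d > 0 \<Longrightarrow> k + reflect d k + 1 = (2 * (k div d) + 1) * d"
  using div_mult_mod_eq[of k d] mod_less_divisor[of d k]
  unfolding reflect_def distrib_right mult.assoc by linarith

lemma reflect_reflect: "d > 0 \<Longrightarrow> reflect d (reflect d k) = k"
proof -
  assume "d > 0"
  then have "reflect d k div d = k div d" "reflect d k mod d = d - 1 - k mod d"
    by (simp_all add: reflect_def)
  then show ?thesis
    using div_mult_mod_eq[of k d] mod_less_divisor[OF \<open>d > 0\<close>, of k]
    by (simp add: reflect_def[of d "reflect d k"])
qed

lemma reflect_less: "d > 0 \<Longrightarrow> d dvd n \<Longrightarrow> k < n \<Longrightarrow> reflect d k < n"
proof -
  assume *: "d > 0" "d dvd n" "k < n"
  then obtain l where l: "n = l * d" by (metis dvd_def mult.commute)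
  have "k div d < l" using * l by (simp add: less_mult_imp_div_less)
  then have "(k div d + 1) * d \<le> n" unfolding l by (intro mult_right_mono) auto
  moreover have "d - 1 - k mod d < d" using * by auto
  ultimately show ?thesis by (simp add: reflect_def)
qed

text \<open>Since a' inverts a, 1 - a' = -a' (1 - a), and likewise for b; the two signs
  cancel.\<close>

lemma factors_reflect:
  fixes a :: "'a::comm_ring_1"
  assumes "a' * a = 1" "b * b' = 1"
  shows "(1 - a') * (1 - b') = a' * b' * ((1 - a) * (1 - b))"
proof -
  have "a' * b' * ((1 - a) * (1 - b)) = (a' - a' * a) * (b' - b * b')"
    by (simp add: algebra_simps)
  also have "\<dots> = (1 - a') * (1 - b')"
    unfolding assms by (simp add: algebra_simps)
  finally show ?thesis ..
qed

text \<open>Induction with \<open>central_Suc\<close>: each step contributes q^(k'-k), where k' is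
  the reflected index. Where d divides j+1 the left factor of that recurrence vanishes, and
  \<open>central_block\<close> supplies the value instead.\<close>

lemma central_reflect:
  assumes "primitive_root d q"
  shows "central q (reflect d k) j = q powi ((int (reflect d k) - int k) * int j) * central q k j"
proof (induction j)
  case (Suc j)
  let ?k' = "reflect d k"
  have q: "q \<noteq> 0" and d: "d > 0"
    using assms primitive_root_nonzero by (auto simp: primitive_root_def)
  show ?case
  proof (cases "d dvd Suc j")
    case True
    have "central q ?k' (Suc j) = central q (k div d * d) (Suc j)"
      unfolding reflect_def using d by (intro central_block[OF assms True]) auto
    also have "\<dots> = central q k (Suc j)"
      using central_block[OF assms True, of "k mod d" "k div d"] d by simp
    moreover have "q powi ((int ?k' - int k) * int (Suc j)) = 1"
      using True by (intro primitive_root_power_int[OF assms] dvd_mult) presburger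
    ultimately show ?thesis by simp
  next
    case False
    define A B A' B' R where "A = q ^ (k + Suc j)" "B = q powi (int k - int j)"
      "A' = q powi (int ?k' - int j)" "B' = q ^ (?k' + Suc j)" "R = q powi (int ?k' - int k)"
    \<comment> \<open>Each of the three products formed next has total exponent k + k' + 1, a
      multiple of d.\<close>
    have one: "q powi (int k + int ?k' + 1) = 1"
      using reflect_sum[OF d, of k] by (intro primitive_root_power_int[OF assms])
       (metis dvd_triv_right of_nat_1 of_nat_add of_nat_dvd_iff)
    have 1: "A' * A = 1" "B * B' = 1" "R * A * B = 1"
      unfolding A_B_A'_B'_R_def one[symmetric] power_int_of_nat[symmetric] power_int_add[OF disjI1, OF q, symmetric]
      by (simp_all add: algebra_simps)
    have "R = A' * B'" using 1 by algebra
    with factors_reflect[OF 1(1,2)] have sym: "(1 - A') * (1 - B') = R * ((1 - A) * (1 - B))" by simp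
    have "q ^ Suc j \<noteq> 1"
      using False assms unfolding primitive_root_def by blast
    then have nz: "(1 - q ^ Suc j)\<^sup>2 \<noteq> 0" by (simp del: power_Suc)
    have "(1 - q ^ Suc j)\<^sup>2 * central q ?k' (Suc j) = (1 - A') * (1 - B') * central q ?k' j"
      unfolding central_Suc[OF q] A_B_A'_B'_R_def ..
    also have "\<dots> = q powi ((int ?k' - int k) * int j) * R * ((1 - A) * (1 - B) * central q k j)"
      unfolding sym Suc.IH by (simp only: mult_ac)
    also have "\<dots> = q powi ((int ?k' - int k) * int j) * R * ((1 - q ^ Suc j)\<^sup>2 * central q k (Suc j))"
      unfolding central_Suc[OF q] A_B_A'_B'_R_def by (simp only: mult_ac)
    also have "q powi ((int ?k' - int k) * int j) * R = q powi ((int ?k' - int k) * int (Suc j))"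
      unfolding A_B_A'_B'_R_def power_int_add[OF disjI1, OF q, symmetric]
        by (simp add: distrib_left add.commute)
    finally show ?thesis using nz by simp
  qed
qed (simp add: central_def)

text \<open>The divisibility hypotheses allow cancelling (1 - q^k)(1 - q^(k+1)) in
  \<open>narayana_central\<close>. Under reflection this product and the factor q^k both acquire
  q^(k'-k), so only the factor from \<open>central_reflect\<close> remains.\<close>

lemma narayana_reflect:
  assumes "primitive_root d q" "\<not> d dvd k" "\<not> d dvd Suc k" "j > 0"
  shows "narayana q (reflect d k) j = q powi ((int (reflect d k) - int k) * int j) * narayana q k j"
proof -
  let ?k' = "reflect d k"
  have q: "q \<noteq> 0" and d: "d > 0"
    using assms primitive_root_nonzero by (auto simp: primitive_root_def)
  have k: "k > 0" using assms(2) by (cases k) auto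
  have dvd: "d dvd k + ?k' + 1" using reflect_sum[OF d, of k] by (metis dvd_triv_right)
  have k': "?k' > 0" using dvd assms(3) by (cases ?k') auto
  define A B A' B' R where "A = q ^ k" "B = q ^ (k + 1)"
    "A' = q ^ ?k'" "B' = q ^ (?k' + 1)" "R = q powi (int ?k' - int k)"
  have one: "q ^ (k + ?k' + 1) = 1"
    using dvd assms(1) by (simp only: primitive_root_def)
  have 1: "A' * B = 1" "A * B' = 1" "R * A = A'"
    using one q by (simp_all add: A_B_A'_B'_R_def power_int_diff power_add field_simps)
  have "R = A' * B'" using 1 by algebra
  with factors_reflect[OF 1(1), of A B'] 1(2)
  have sym: "(1 - A') * (1 - B') = R * ((1 - A) * (1 - B))" by (simp add: mult_ac)
  have "A \<noteq> 1" "B \<noteq> 1"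
    using assms by (auto simp: A_B_A'_B'_R_def primitive_root_def simp del: power_Suc)
  moreover have "R \<noteq> 0" using q by (simp add: A_B_A'_B'_R_def)
  ultimately have nz: "R * ((1 - A) * (1 - B)) \<noteq> 0" by simp
  have "R * ((1 - A) * (1 - B)) * narayana q ?k' j = (1 - q) * A' * (1 - q ^ j) * central q ?k' j"
    using narayana_central[OF q k' assms(4)] unfolding sym[symmetric] by (simp add: A_B_A'_B'_R_def)
  also have "\<dots> = R * q powi ((int ?k' - int k) * int j) * ((1 - q) * A * (1 - q ^ j) * central q k j)"
    unfolding central_reflect[OF assms(1)] 1(3)[symmetric] by (simp add: mult_ac)
  also have "(1 - q) * A * (1 - q ^ j) * central q k j = (1 - A) * (1 - B) * narayana q k j"
    using narayana_central[OF q k assms(4)] by (simp add: A_B_A'_B'_R_def)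
  finally have "R * ((1 - A) * (1 - B)) * narayana q ?k' j =
      R * ((1 - A) * (1 - B)) * (q powi ((int ?k' - int k) * int j) * narayana q k j)"
    by (simp only: mult_ac)
  then show ?thesis using nz by (simp only: mult_cancel_left) simp
qed

lemma reflect_dvd:
  assumes "d > 0"
  shows "d dvd reflect d k \<longleftrightarrow> d dvd Suc k" "d dvd Suc (reflect d k) \<longleftrightarrow> d dvd k"
proof -
  have "d dvd k + reflect d k + 1"
    using reflect_sum[OF assms, of k] by (metis dvd_triv_right)
  then have 1: "d dvd Suc k + reflect d k" and 2: "d dvd k + Suc (reflect d k)" by simp_all
  show "d dvd reflect d k \<longleftrightarrow> d dvd Suc k" using 1 by (metis dvd_add_right_iff dvd_add_left_iff)
  show "d dvd Suc (reflect d k) \<longleftrightarrow> d dvd k" using 2 by (metis dvd_add_right_iff dvd_add_left_iff)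
qed

section \<open>The polynomials \<open>w\<close> extended to roots of unity, and their
  reflection\<close>

definition w_gauss :: "nat \<Rightarrow> nat \<Rightarrow> 'a::field \<Rightarrow> 'a poly" where
  "w_gauss \<alpha> k q = (\<Sum>j=1..k. monom
     (q powi (int \<alpha> * (int ((j + 1) choose 2) - (int k + 1) * (int j - 1))) * narayana q k j ^ \<alpha>)
     (j - 1))"

lemma w_eq_w_gauss:
  fixes q :: "'a::field"
  assumes "q \<noteq> 0" "\<And>i. i > 0 \<Longrightarrow> q ^ i \<noteq> 1"
  shows "w \<alpha> k q = w_gauss \<alpha> k q"
  unfolding w_def w_gauss_def
proof (rule sum.cong[OF refl])
  fix j assume "j \<in> {1..k}"
  then have "int j - 1 = int (j - 1)" by auto
  then show "monom (q powi (int \<alpha> * (int ((j + 1) choose 2) - (int k + 1) * (int j - 1))) *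
      (qbinom q (k - 1) (int j - 1) * qbinom q (k + j) (int j) -
       qbinom q k (int j) * qbinom q (k + j) (int j - 1)) ^ \<alpha>) (j - 1) =
     monom (q powi (int \<alpha> * (int ((j + 1) choose 2) - (int k + 1) * (int j - 1))) * narayana q k j ^ \<alpha>)
     (j - 1)"
    by (simp only: qbinom_eq_gauss[OF assms] narayana_def)
qed

text \<open>The formula covers every i: for i at least k both Gaussian products vanish, and \<alpha>
  > 0 makes the power vanish as well.\<close>

lemma coeff_w_gauss:
  assumes "\<alpha> > 0" "k > 0"
  shows "coeff (w_gauss \<alpha> k q) i =
    q powi (int \<alpha> * (int ((i + 2) choose 2) - (int k + 1) * int i)) * narayana q k (Suc i) ^ \<alpha>"
proof (cases "i < k")
  case True
  have "coeff (w_gauss \<alpha> k q) i = (\<Sum>j=1..k. if j = Suc i then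
    q powi (int \<alpha> * (int ((j + 1) choose 2) - (int k + 1) * (int j - 1))) * narayana q k j ^ \<alpha> else 0)"
    unfolding w_gauss_def coeff_sum by (intro sum.cong) auto
  then show ?thesis using True by simp
next
  case False
  then have "narayana q k (Suc i) = 0"
    using assms by (simp add: narayana_def gauss_eq_0)
  moreover have "coeff (w_gauss \<alpha> k q) i = 0"
    unfolding w_gauss_def coeff_sum using False by (intro sum.neutral) auto
  ultimately show ?thesis using assms by simp
qed

text \<open>With D = k' - k, the prefactor changes by the exponent -\<alpha> D i and the power of
  \<open>narayana\<close> by \<alpha> D (i+1). The total \<alpha> D is independent of i, so one
  scalar serves all coefficients.\<close>

lemma w_gauss_reflect:
  assumes "primitive_root d q" "\<not> d dvd k" "\<not> d dvd Suc k" "\<alpha> > 0"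
  shows "w_gauss \<alpha> (reflect d k) q = smult (q powi (int \<alpha> * (int (reflect d k) - int k))) (w_gauss \<alpha> k q)"
proof (rule poly_eqI)
  fix i
  have q: "q \<noteq> 0" and d: "d > 0"
    using assms primitive_root_nonzero by (auto simp: primitive_root_def)
  have k: "k > 0" using assms(2) by (cases k) auto
  have k': "reflect d k > 0" using assms(3) reflect_dvd(1)[OF d, of k] by (metis dvd_0_right gr0I)
  let ?c = "int ((i + 2) choose 2)" and ?D = "int (reflect d k) - int k"
  have "coeff (w_gauss \<alpha> (reflect d k) q) i =
      q powi (int \<alpha> * (?c - (int (reflect d k) + 1) * int i)) * q powi (?D * int (Suc i) * int \<alpha>) *
      narayana q k (Suc i) ^ \<alpha>"
    unfolding coeff_w_gauss[OF assms(4) k'] narayana_reflect[OF assms(1-3) zero_less_Suc]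
      power_mult_distrib power_int_power' by (simp only: mult.assoc)
  also have "q powi (int \<alpha> * (?c - (int (reflect d k) + 1) * int i)) * q powi (?D * int (Suc i) * int \<alpha>)
      = q powi (int \<alpha> * ?D) * q powi (int \<alpha> * (?c - (int k + 1) * int i))"
    unfolding power_int_add[OF disjI1, OF q, symmetric]
    by (rule arg_cong[of _ _ "(powi) q"]) (simp add: algebra_simps)
  finally show "coeff (w_gauss \<alpha> (reflect d k) q) i =
      coeff (smult (q powi (int \<alpha> * ?D)) (w_gauss \<alpha> k q)) i"
    unfolding coeff_smult coeff_w_gauss[OF assms(4) k] by (simp only: mult.assoc)
qed

section \<open>Antisymmetry of the summand under reflection\<close>

definition summand :: "nat \<Rightarrow> nat \<Rightarrow> nat \<Rightarrow> nat \<Rightarrow> 'a::field \<Rightarrow> nat \<Rightarrow> 'a poly" where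
  "summand \<alpha> m n r q k = smult
     ((-1) ^ k * qint (q\<^sup>2) (int (k * (k + 1))) ^ r * qint q (int (2 * k + 1)) *
       q ^ ((n - 1 - k) * (2 * \<alpha> * m + 1)))
     (w_gauss \<alpha> k (q\<^sup>2) ^ m)"

text \<open>Let s = q^d, which is 1 for odd d and -1 for even d. If d divides neither k nor k+1, the
  sign contributes s, [2k+1] contributes -s q^(k'-k), and the power of q together with
  \<open>w_gauss\<close> contributes q^(k-k'). As s^2 = 1, the product is -1.\<close>

lemma summand_reflect:
  fixes q :: "'a::field"
  assumes d: "primitive_root d (q\<^sup>2)" "q ^ d = - ((-1) ^ d)" "d dvd n" "k < n"
    and pos: "\<alpha> > 0" "r > 0"
  shows "summand \<alpha> m n r q (reflect d k) = - summand \<alpha> m n r q k"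
proof (cases "d dvd k \<or> d dvd Suc k")
  case True
  have d0: "d > 0" using d by (simp add: primitive_root_def)
  \<comment> \<open>Here d divides i(i+1), so the q-integer is 0, and r > 0 keeps its power
    0.\<close>
  have zero: "summand \<alpha> m n r q i = 0" if "d dvd i \<or> d dvd Suc i" for i
  proof -
    have "d dvd i * (i + 1)"
      using that by (metis Suc_eq_plus1 dvd_mult dvd_mult2)
    then have "(q\<^sup>2) ^ (i * (i + 1)) = 1"
      using d(1) unfolding primitive_root_def by blast
    then show ?thesis using pos by (simp only: summand_def qint_of_nat) simp
  qed
  have "summand \<alpha> m n r q (reflect d k) = 0" "summand \<alpha> m n r q k = 0"
    using True by (intro zero; simp add: reflect_dvd[OF d0]; blast)+
  then show ?thesis by simp
next
  case False
  let ?k' = "reflect d k"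
  have d0: "d > 0" and q: "q \<noteq> 0"
    using primitive_root_nonzero[OF d(1)] d(1) by (simp_all add: primitive_root_def)
  have k'n: "?k' < n" using reflect_less[OF d0 d(3,4)] .
  define s :: 'a where "s = - ((-1) ^ d)"
  have s2: "s * s = 1" by (simp add: s_def flip: power_mult_distrib)
  \<comment> \<open>This is an odd multiple of d, so q and -1 raised to it give s and -s.\<close>
  have sum: "k + ?k' + 1 = (2 * (k div d) + 1) * d" by (rule reflect_sum[OF d0])
  have "q ^ (k + ?k' + 1) = (q ^ d) ^ (2 * (k div d) + 1)"
    unfolding sum by (simp only: mult.commute[of _ d] power_mult)
  also have "\<dots> = s" using s2
    by (simp add: d(2) power_mult power2_eq_square flip: s_def)
  finally have qs: "q ^ (k + ?k' + 1) = s" .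
  have "(-1 :: 'a) ^ (k + ?k' + 1) = ((-1) ^ d) ^ (2 * (k div d) + 1)"
    unfolding sum by (simp only: mult.commute[of _ d] power_mult)
  also have "\<dots> = (- s :: 'a)" by (simp add: s_def power_mult power2_eq_square flip: power_mult_distrib)
  finally have s: "s = (-1) ^ k * (-1) ^ ?k'"
    by (simp add: power_add)
  have sign: "(-1) ^ ?k' = (-1) ^ k * s"
    unfolding s mult.assoc[symmetric] power_mult_distrib[symmetric] by simp
  have sq: "qint (q\<^sup>2) (int (?k' * (?k' + 1))) = qint (q\<^sup>2) (int (k * (k + 1)))"
  proof -
    have "[?k' * (?k' + 1) = k * (k + 1)] (mod d)"
    proof -
      have "int (?k' * (?k' + 1)) - int (k * (k + 1)) = int (k + ?k' + 1) * (int ?k' - int k)"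
        by (simp add: algebra_simps)
      moreover have "int d dvd int (k + ?k' + 1)"
        unfolding sum by simp
      ultimately have "int d dvd int (?k' * (?k' + 1)) - int (k * (k + 1))"
        by (simp only: dvd_mult2)
      then show ?thesis by (simp only: cong_iff_dvd_diff flip: cong_int_iff)
    qed
    then show ?thesis
      unfolding qint_of_nat using primitive_root_power_cong[OF d(1)] by simp
  qed
  have split: "q ^ (2 * ?k' + 1) = q powi (int ?k' - int k) * s"
    unfolding qs[symmetric] power_int_of_nat[symmetric] power_int_add[OF disjI1, OF q, symmetric]
    by (simp add: add.commute)
  have inverse: "q ^ (2 * ?k' + 1) * q ^ (2 * k + 1) = 1"
  proof -
    have "q ^ (2 * ?k' + 1) * q ^ (2 * k + 1) = q ^ (k + ?k' + 1) * q ^ (k + ?k' + 1)"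
      unfolding power_add[symmetric] by (rule arg_cong[of _ _ "(^) q"]) simp
    then show ?thesis by (simp only: qs s2)
  qed
  have odd: "qint q (int (2 * ?k' + 1)) = - (q powi (int ?k' - int k) * s * qint q (int (2 * k + 1)))"
  proof -
    have "1 - q ^ (2 * ?k' + 1) = - (q ^ (2 * ?k' + 1) * (1 - q ^ (2 * k + 1)))"
      using inverse by (simp only: right_diff_distrib) simp
    then show ?thesis unfolding qint_of_nat split by simp
  qed
  \<comment> \<open>Passing from n-1-k' to n-1-k adds (k'-k)(2\<alpha>m+1) to the exponent;
    \<open>w_gauss\<close> provides all but k'-k of it.\<close>
  have pw: "q ^ ((n - 1 - ?k') * (2 * \<alpha> * m + 1)) * ((q\<^sup>2) powi (int \<alpha> * (int ?k' - int k))) ^ m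
     = q powi (int k - int ?k') * q ^ ((n - 1 - k) * (2 * \<alpha> * m + 1))"
  proof -
    have "(q\<^sup>2) powi (int \<alpha> * (int ?k' - int k)) = q powi (2 * (int \<alpha> * (int ?k' - int k)))"
      by (simp add: power_int_mult)
    moreover have "int (n - 1 - ?k') = int n - 1 - int ?k'" "int (n - 1 - k) = int n - 1 - int k"
      using k'n d(4) by auto
    ultimately show ?thesis
      unfolding power_int_of_nat[symmetric] power_int_mult[symmetric]
        power_int_add[OF disjI1, OF q, symmetric] of_nat_mult
      by (simp add: algebra_simps)
  qed
  have cancel: "q powi (int ?k' - int k) * q powi (int k - int ?k') = 1"
    using q by (simp flip: power_int_add)
  have "(-1) ^ ?k' * qint (q\<^sup>2) (int (?k' * (?k' + 1))) ^ r * qint q (int (2 * ?k' + 1)) *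
       q ^ ((n - 1 - ?k') * (2 * \<alpha> * m + 1)) * ((q\<^sup>2) powi (int \<alpha> * (int ?k' - int k))) ^ m
     = ((-1) ^ k * s) * qint (q\<^sup>2) (int (k * (k + 1))) ^ r *
       - (q powi (int ?k' - int k) * s * qint q (int (2 * k + 1))) *
       (q powi (int k - int ?k') * q ^ ((n - 1 - k) * (2 * \<alpha> * m + 1)))"
    unfolding sq odd sign pw[symmetric] by (simp only: mult.assoc)
  also have "\<dots> = - (s * s * (q powi (int ?k' - int k) * q powi (int k - int ?k')) *
      ((-1) ^ k * qint (q\<^sup>2) (int (k * (k + 1))) ^ r * qint q (int (2 * k + 1)) *
       q ^ ((n - 1 - k) * (2 * \<alpha> * m + 1))))"
    by (simp only: mult_minus_left mult_minus_right mult_ac)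
  finally have main: "(-1) ^ ?k' * qint (q\<^sup>2) (int (?k' * (?k' + 1))) ^ r * qint q (int (2 * ?k' + 1)) *
       q ^ ((n - 1 - ?k') * (2 * \<alpha> * m + 1)) * ((q\<^sup>2) powi (int \<alpha> * (int ?k' - int k))) ^ m
     = - ((-1) ^ k * qint (q\<^sup>2) (int (k * (k + 1))) ^ r * qint q (int (2 * k + 1)) *
       q ^ ((n - 1 - k) * (2 * \<alpha> * m + 1)))"
    unfolding s2 cancel by (simp only: mult_1_left)
  have "w_gauss \<alpha> ?k' (q\<^sup>2) = smult ((q\<^sup>2) powi (int \<alpha> * (int ?k' - int k))) (w_gauss \<alpha> k (q\<^sup>2))"
    using False by (intro w_gauss_reflect d(1) pos(1)) auto
  then show ?thesis
    by (simp only: summand_def smult_power smult_smult main smult_minus_left)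
qed

lemma sum_summand_eq_0:
  fixes q :: "'a::field_char_0"
  assumes d: "primitive_root d (q\<^sup>2)" "q ^ d = - ((-1) ^ d)" "d dvd n"
    and pos: "\<alpha> > 0" "r > 0"
  shows "(\<Sum>k<n. summand \<alpha> m n r q k) = 0"
proof -
  have d0: "d > 0" using d by (simp add: primitive_root_def)
  have "(\<Sum>k<n. summand \<alpha> m n r q k) = (\<Sum>k<n. summand \<alpha> m n r q (reflect d k))"
    by (rule sum.reindex_bij_witness[of _ "reflect d" "reflect d"])
      (auto simp: reflect_reflect reflect_less d0 d)
  also have "\<dots> = - (\<Sum>k<n. summand \<alpha> m n r q k)"
    unfolding sum_negf[symmetric] by (intro sum.cong) (auto intro!: summand_reflect d pos)
  \<comment> \<open>The sum equals its negative, so characteristic 0 forces it to vanish.\<close>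
  finally have "2 * (\<Sum>k<n. summand \<alpha> m n r q k) = 0"
    by (metis add.right_inverse mult_2)
  then show ?thesis by simp
qed

section \<open>Specialization of Laurent polynomials\<close>

lemma qq_power: "qq ^ i = to_fract (monom 1 i)"
proof (induction i)
  case (Suc i)
  have "monom 1 (Suc i) = [:0, 1:] * (monom 1 i :: int poly)"
    by (simp add: monom_Suc)
  then show ?case using Suc by (simp only: power_Suc to_fract_mult) (simp add: qq_def)
qed simp

lemma qq_nonzero: "qq \<noteq> 0"
  by (simp add: qq_def)

lemma qq_square_power_neq_1:
  assumes "i > 0"
  shows "(qq\<^sup>2) ^ i \<noteq> 1"
proof
  assume "(qq\<^sup>2) ^ i = 1"
  then have "qq ^ (2 * i) = 1"
    by (simp add: power_mult)
  then have "to_fract (monom 1 (2 * i)) = to_fract (1 :: int poly)"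
    by (simp add: qq_power)
  then have "monom 1 (2 * i) = (1 :: int poly)"
    by (simp only: to_fract_eq_iff)
  then have "degree (monom 1 (2 * i) :: int poly) = degree (1 :: int poly)"
    by (rule arg_cong)
  then show False using assms by (simp add: degree_monom_eq)
qed

lemma to_fract_of_int: "to_fract [:i:] = of_int i"
proof -
  have nat: "to_fract (of_nat n) = (of_nat n :: ratfun)" for n
    by (induction n) simp_all
  have "to_fract (of_int i) = (of_int i :: ratfun)" by (cases i rule: int_cases2) (simp_all add: nat)
  then show ?thesis by (simp add: of_int_poly)
qed

lemma cpoly_monom: "cpoly (monom 1 i) = monom 1 i"
  by (simp add: map_poly_monom)

text \<open>Evaluation at z as a relation: it records at once that \<open>f\<close> is a Laurent
  polynomial and that \<open>c\<close> is its value, without fixing a representation as a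
  fraction.\<close>

definition specializes :: "complex \<Rightarrow> ratfun \<Rightarrow> complex \<Rightarrow> bool" where
  "specializes z f c \<longleftrightarrow> (\<exists>p i. f = to_fract p / qq ^ i \<and> c = poly (cpoly p) z / z ^ i)"

lemma specializes_laurent_ring: "specializes z f c \<Longrightarrow> f \<in> laurent_ring"
  by (auto simp: specializes_def laurent_ring_def)

text \<open>Two representations agree after cross-multiplication by powers of q; evaluating there
  and dividing by powers of the nonzero z gives equal values.\<close>

lemma specializes_unique:
  assumes "specializes z (to_fract p / qq ^ i) c" "z \<noteq> 0"
  shows "c = poly (cpoly p) z / z ^ i"
proof -
  obtain p' j where *: "to_fract p / qq ^ i = to_fract p' / qq ^ j" "c = poly (cpoly p') z / z ^ j"
    using assms by (auto simp: specializes_def)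
  then have "to_fract p * qq ^ j = to_fract p' * qq ^ i"
    by (simp add: qq_nonzero field_simps)
  then have "to_fract (p * monom 1 j) = to_fract (p' * monom 1 i)"
    by (simp add: qq_power)
  then have "p * monom 1 j = p' * monom 1 i"
    by (simp only: to_fract_eq_iff)
  then have "poly (cpoly (p * monom 1 j)) z = poly (cpoly (p' * monom 1 i)) z"
    by simp
  then have "poly (cpoly p) z * z ^ j = poly (cpoly p') z * z ^ i"
    by (simp add: cpoly_mult cpoly_monom poly_monom)
  then show ?thesis using assms(2) unfolding *(2)
    by (simp add: frac_eq_eq)
qed

section \<open>Compatibility of specialization with arithmetic and the q-analogues\<close>

context
  fixes z :: complex
  assumes z: "z \<noteq> 0"
begin

lemma specializes_to_fract: "specializes z (to_fract p) (poly (cpoly p) z)"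
  unfolding specializes_def by (intro exI[of _ p] exI[of _ 0]) simp

lemma specializes_of_int: "specializes z (of_int i) (of_int i)"
  using specializes_to_fract[of "[:i:]"] by (simp add: to_fract_of_int map_poly_pCons)

lemma specializes_0: "specializes z 0 0" and specializes_1: "specializes z 1 1"
  using specializes_to_fract[of 0] specializes_to_fract[of 1] by simp_all

lemma specializes_qq: "specializes z qq z"
  using specializes_to_fract[of "[:0, 1:]"] by (simp add: qq_def map_poly_pCons)

lemma specializes_inverse_qq: "specializes z (inverse qq) (inverse z)"
  unfolding specializes_def
  by (intro exI[of _ 1] exI[of _ "Suc 0"]) (simp add: inverse_eq_divide)

lemma specializes_mult:
  assumes "specializes z f c" "specializes z g e"
  shows "specializes z (f * g) (c * e)"
proof -
  obtain p i p' j where "f = to_fract p / qq ^ i" "c = poly (cpoly p) z / z ^ i"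
    "g = to_fract p' / qq ^ j" "e = poly (cpoly p') z / z ^ j"
    using assms by (auto simp: specializes_def)
  then show ?thesis
    unfolding specializes_def
    by (intro exI[of _ "p * p'"] exI[of _ "i + j"]) (simp add: cpoly_mult power_add)
qed

lemma specializes_add:
  assumes "specializes z f c" "specializes z g e"
  shows "specializes z (f + g) (c + e)"
proof -
  obtain p i p' j where "f = to_fract p / qq ^ i" "c = poly (cpoly p) z / z ^ i"
    "g = to_fract p' / qq ^ j" "e = poly (cpoly p') z / z ^ j"
    using assms by (auto simp: specializes_def)
  moreover have "to_fract p / qq ^ i + to_fract p' / qq ^ j =
      to_fract (p * monom 1 j + p' * monom 1 i) / qq ^ (i + j)"
    using qq_nonzero by (simp add: power_add add_frac_eq flip: qq_power)
  moreover have "poly (cpoly p) z / z ^ i + poly (cpoly p') z / z ^ j =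
      poly (cpoly (p * monom 1 j + p' * monom 1 i)) z / z ^ (i + j)"
    using z by (simp add: cpoly_mult cpoly_add cpoly_monom poly_monom power_add add_frac_eq)
  ultimately show ?thesis unfolding specializes_def by metis
qed

lemma specializes_uminus: "specializes z f c \<Longrightarrow> specializes z (- f) (- c)"
  using specializes_mult[OF specializes_of_int[of "-1"]] by simp

lemma specializes_diff: "specializes z f c \<Longrightarrow> specializes z g e \<Longrightarrow> specializes z (f - g) (c - e)"
  using specializes_add[OF _ specializes_uminus] by simp

lemma specializes_power: "specializes z f c \<Longrightarrow> specializes z (f ^ i) (c ^ i)"
  by (induction i) (simp_all add: specializes_1 specializes_mult)

lemma specializes_sum:
  "(\<And>i. i \<in> A \<Longrightarrow> specializes z (f i) (c i)) \<Longrightarrow> specializes z (\<Sum>i\<in>A. f i) (\<Sum>i\<in>A. c i)"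
  by (induction A rule: infinite_finite_induct) (simp_all add: specializes_0 specializes_add)

text \<open>A Laurent polynomial need not have a Laurent inverse, hence the separate hypothesis on
  inverses.\<close>

lemma specializes_power_int:
  "specializes z f c \<Longrightarrow> specializes z (inverse f) (inverse c) \<Longrightarrow> specializes z (f powi i) (c powi i)"
  by (simp add: power_int_def specializes_power)

text \<open>Both quotients are geometric sums because neither base is 1.\<close>

lemma specializes_qint:
  assumes "specializes z f c" "f \<noteq> 1" "c \<noteq> 1"
  shows "specializes z (qint f (int n)) (qint c (int n))"
proof -
  have "specializes z (\<Sum>i<n. f ^ i) (\<Sum>i<n. c ^ i)"
    by (intro specializes_sum specializes_power assms)
  then show ?thesis using assms by (simp only: qint_of_nat sum_gp_strict) simp
qed

lemma specializes_gauss: "specializes z f c \<Longrightarrow> specializes z (gauss f n k) (gauss c n k)"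
  by (induction f n k rule: gauss.induct)
    (simp_all add: gauss.simps(3) specializes_0 specializes_1 specializes_add specializes_mult specializes_power
      del: power_Suc)

lemma specializes_narayana: "specializes z f c \<Longrightarrow> specializes z (narayana f k j) (narayana c k j)"
  unfolding narayana_def by (intro specializes_diff specializes_mult specializes_gauss)

definition specializes_poly :: "ratfun poly \<Rightarrow> complex poly \<Rightarrow> bool" where
  "specializes_poly f g \<longleftrightarrow> (\<forall>i. specializes z (coeff f i) (coeff g i))"

lemma specializes_poly_sum:
  "(\<And>i. i \<in> A \<Longrightarrow> specializes_poly (f i) (g i)) \<Longrightarrow> specializes_poly (\<Sum>i\<in>A. f i) (\<Sum>i\<in>A. g i)"
  by (auto simp: specializes_poly_def coeff_sum intro: specializes_sum)

lemma specializes_poly_monom: "specializes z f c \<Longrightarrow> specializes_poly (monom f i) (monom c i)"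
  by (simp add: specializes_poly_def specializes_0)

lemma specializes_poly_smult:
  "specializes z f c \<Longrightarrow> specializes_poly p g \<Longrightarrow> specializes_poly (smult f p) (smult c g)"
  by (simp add: specializes_poly_def specializes_mult)

lemma specializes_poly_mult:
  "specializes_poly p g \<Longrightarrow> specializes_poly p' g' \<Longrightarrow> specializes_poly (p * p') (g * g')"
  by (simp add: specializes_poly_def coeff_mult specializes_mult specializes_sum)

lemma specializes_poly_power: "specializes_poly p g \<Longrightarrow> specializes_poly (p ^ i) (g ^ i)"
proof (induction i)
  case 0
  then show ?case using specializes_poly_monom[OF specializes_1, of 0] by (simp add: one_pCons monom_0)
qed (simp add: specializes_poly_mult)

lemma specializes_w_gauss:
  assumes "specializes z f c" "specializes z (inverse f) (inverse c)"
  shows "specializes_poly (w_gauss \<alpha> k f) (w_gauss \<alpha> k c)"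
  unfolding w_gauss_def
  by (intro specializes_poly_sum specializes_poly_monom specializes_mult specializes_power_int
    specializes_power specializes_narayana assms)

lemma specializes_summand:
  assumes "z\<^sup>2 \<noteq> 1"
  shows "specializes_poly (summand \<alpha> m n r qq k) (summand \<alpha> m n r z k)"
proof -
  have "qq\<^sup>2 \<noteq> 1" using qq_square_power_neq_1[of 1] by simp
  moreover have "qq \<noteq> 1" "z \<noteq> 1" using calculation assms by auto
  moreover have "specializes z (-1) (-1)"
    using specializes_of_int[of "-1"] by simp
  moreover have "specializes z (inverse (qq\<^sup>2)) (inverse (z\<^sup>2))"
    using specializes_power[OF specializes_inverse_qq, of 2] by (simp add: power_inverse)
  ultimately show ?thesis
    unfolding summand_def
    by (intro specializes_poly_smult specializes_poly_power specializes_w_gauss specializes_mult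
      specializes_power specializes_qint specializes_qq assms)
qed

end

section \<open>Squarefreeness and roots of the divisor\<close>

lemma primitive_root_cis:
  assumes "coprime k d" "d > 0"
  shows "primitive_root d (cis (2 * pi * real k / real d))"
  unfolding primitive_root_def
proof (intro conjI allI)
  fix i
  have "cis (2 * pi * real k / real d) ^ i = 1 \<longleftrightarrow> cos (2 * pi * real (k * i) / real d) = 1"
  proof -
    have "sin x = 0" if "cos x = 1" for x :: real using that by (rule cos_one_sin_zero)
    then show ?thesis by (auto simp: DeMoivre complex_eq_iff mult_ac)
  qed
  also have "\<dots> \<longleftrightarrow> (\<exists>x::int. 2 * pi * real (k * i) / real d = of_int x * 2 * pi)"
    by (rule cos_one_2pi_int)
  also have "\<dots> \<longleftrightarrow> (\<exists>x::int. int (k * i) = int d * x)"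
  proof (intro ex_cong1)
    fix x :: int
    have "2 * pi * real (k * i) / real d = of_int x * 2 * pi \<longleftrightarrow> real (k * i) = real d * of_int x"
      using assms(2) by (simp add: field_simps)
    also have "\<dots> \<longleftrightarrow> real_of_int (int (k * i)) = real_of_int (int d * x)" by simp
    finally show "2 * pi * real (k * i) / real d = of_int x * 2 * pi \<longleftrightarrow> int (k * i) = int d * x"
      by (simp only: of_int_eq_iff)
  qed
  also have "\<dots> \<longleftrightarrow> d dvd k * i"
    by (metis dvd_def int_dvd_int_iff)
  also have "\<dots> \<longleftrightarrow> d dvd i"
    using assms(1) by (simp add: coprime_commute coprime_dvd_mult_right_iff)
  finally show "cis (2 * pi * real k / real d) ^ i = 1 \<longleftrightarrow> d dvd i" .
qed (use assms in auto)

text \<open>A primitive d-th root of unity is a root of x^d - 1, hence of the factor for some e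
  dividing d; it then has order e as well as d, so e = d.\<close>

lemma poly_complex_cyclotomic_eq_0_iff:
  assumes "d > 0"
  shows "poly (complex_cyclotomic d) z = 0 \<longleftrightarrow> primitive_root d z"
proof -
  have imp: "primitive_root e z" if "poly (complex_cyclotomic e) z = 0" "e > 0" for e
    using that by (auto simp: complex_cyclotomic_def poly_prod totatives_def primitive_root_cis)
  show ?thesis
  proof
    assume prim: "primitive_root d z"
    then have "z ^ d = 1" by (simp add: primitive_root_def)
    then have "poly (\<Prod>e | e dvd d. complex_cyclotomic e) z = 0"
      unfolding prod_complex_cyclotomic[OF assms] by (simp add: poly_monom)
    then obtain e where e: "e dvd d" "poly (complex_cyclotomic e) z = 0"
      using assms by (auto simp: poly_prod)
    moreover have "e > 0" using e assms by (auto intro: Nat.gr0I)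
    ultimately have "primitive_root e z" by (intro imp)
    then have "e = d" using prim unfolding primitive_root_def by (metis dvd_antisym dvd_refl)
    then show "poly (complex_cyclotomic d) z = 0" using e by simp
  qed (rule imp[OF _ assms])
qed

text \<open>A common root of a factor and its derivative is a common root of the product and its
  derivative.\<close>

lemma rsquarefree_dvd:
  fixes p q :: "'a::field_char_0 poly"
  assumes "q dvd p" "rsquarefree p"
  shows "rsquarefree q"
  using assms by (auto simp: rsquarefree_roots pderiv_mult)

lemma rsquarefree_unity:
  assumes "n > 0"
  shows "rsquarefree (monom 1 n - 1 :: 'a::field_char_0 poly)"
  using assms by (auto simp: rsquarefree_roots pderiv_diff pderiv_monom poly_monom power_0_left)

lemma prod_linear_dvd:
  fixes p :: "'a::idom poly"
  assumes "finite A" "\<And>z. z \<in> A \<Longrightarrow> poly p z = 0"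
  shows "(\<Prod>z\<in>A. [:- z, 1:]) dvd p"
  using assms
proof (induction A rule: finite_induct)
  case (insert a A)
  then obtain q where q: "p = (\<Prod>z\<in>A. [:- z, 1:]) * q" by (auto simp: dvd_def)
  have "poly (\<Prod>z\<in>A. [:- z, 1:]) a \<noteq> 0" using insert by (auto simp: poly_prod)
  then have "[:- a, 1:] dvd q" using insert.prems[of a] by (simp add: q poly_eq_0_iff_dvd)
  then have "[:- a, 1:] * (\<Prod>z\<in>A. [:- z, 1:]) dvd q * (\<Prod>z\<in>A. [:- z, 1:])"
    by (rule mult_dvd_mono) simp
  then show ?case unfolding prod.insert[OF insert.hyps] q mult.commute[of q] .
qed simp

text \<open>Up to its leading coefficient, \<open>p\<close> is a product of distinct linear factors,
  and each of them divides \<open>q\<close>.\<close>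

lemma rsquarefree_dvd_if_roots:
  fixes p q :: "complex poly"
  assumes "rsquarefree p" "\<And>z. poly p z = 0 \<Longrightarrow> poly q z = 0"
  shows "p dvd q"
proof -
  have "p \<noteq> 0" using assms by (simp add: rsquarefree_def)
  then have "(\<Prod>z | poly p z = 0. [:- z, 1:]) dvd q"
    using assms by (intro prod_linear_dvd poly_roots_finite) auto
  then have "smult (lead_coeff p) (\<Prod>z | poly p z = 0. [:- z, 1:]) dvd q"
    using \<open>p \<noteq> 0\<close> by (simp add: smult_dvd_iff)
  then show ?thesis using complex_poly_decompose_rsquarefree[OF assms(1)] by simp
qed

lemma primitive_root_square:
  assumes "primitive_root d z" "odd d"
  shows "primitive_root d (z\<^sup>2)"
proof -
  have "(z\<^sup>2) ^ i = 1 \<longleftrightarrow> d dvd i" for i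
    using assms by (simp add: primitive_root_def coprime_dvd_mult_right_iff flip: power_mult)
  then show ?thesis using assms by (simp add: primitive_root_def)
qed

text \<open>For d = 2e, z^d = (z^2)^e is not 1 because d does not divide e, but its square (z^2)^d
  is 1.\<close>

lemma power_eq_minus_1:
  fixes z :: "'a::field"
  assumes "primitive_root d (z\<^sup>2)" "even d"
  shows "z ^ d = -1"
proof -
  obtain e where e: "d = 2 * e" using assms(2) by blast
  have "\<not> d dvd e" using assms e by (auto simp: primitive_root_def dest: dvd_imp_le)
  then have "z ^ d \<noteq> 1" using assms(1) by (simp add: e primitive_root_def power_mult)
  moreover have "(z ^ d)\<^sup>2 = 1" using assms(1)
    by (simp add: primitive_root_def power_mult[symmetric] mult.commute)
  ultimately show ?thesis by (simp add: power2_eq_1_iff)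
qed

section \<open>The divisor as a monic integer polynomial and its complex roots\<close>

definition divisor :: "nat \<Rightarrow> int poly" where
  "divisor n = (\<Prod>d | d dvd n \<and> d > 1 \<and> odd d. cyclotomic d) *
     (\<Prod>d | d dvd n \<and> d > 1 \<and> even d. pcompose (cyclotomic d) [:0, 0, 1:])"

lemma cpoly_pcompose: "cpoly (pcompose p q) = pcompose (cpoly p) (cpoly q)"
  by (induction p) (simp_all add: pcompose_pCons map_poly_pCons cpoly_add cpoly_mult)

lemma cyclotomic_at_to_fract: "cyclotomic_at d (to_fract r) = to_fract (pcompose (cyclotomic d) r)"
proof -
  have "poly (map_poly of_int p) (to_fract r) = to_fract (pcompose p r)" for p
    by (induction p) (simp_all add: pcompose_pCons map_poly_pCons to_fract_of_int)
  then show ?thesis by (simp add: cyclotomic_at_def)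
qed

lemma to_fract_prod: "to_fract (\<Prod>i\<in>A. f i) = (\<Prod>i\<in>A. to_fract (f i))"
  by (induction A rule: infinite_finite_induct) simp_all

lemma to_fract_divisor:
  "to_fract (divisor n) = (\<Prod>d | d dvd n \<and> d > 1 \<and> odd d. cyclotomic_at d qq) *
      (\<Prod>d | d dvd n \<and> d > 1 \<and> even d. cyclotomic_at d (qq\<^sup>2))"
proof -
  have "cyclotomic_at d qq = to_fract (cyclotomic d)" for d
    by (simp add: qq_def cyclotomic_at_to_fract pcompose_idR)
  moreover have "qq\<^sup>2 = to_fract [:0, 0, 1:]"
    by (simp add: qq_def power2_eq_square flip: to_fract_mult)
  ultimately show ?thesis
    by (simp add: divisor_def to_fract_prod cyclotomic_at_to_fract)
qed

lemma cpoly_divisor: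
  "cpoly (divisor n) = (\<Prod>d | d dvd n \<and> d > 1 \<and> odd d. complex_cyclotomic d) *
     (\<Prod>d | d dvd n \<and> d > 1 \<and> even d. pcompose (complex_cyclotomic d) [:0, 0, 1:])"
  by (simp add: divisor_def cpoly_mult cpoly_prod cpoly_pcompose of_int_cyclotomic map_poly_pCons)

lemma lead_coeff_divisor: "lead_coeff (divisor n) = 1"
proof -
  have "lead_coeff (cpoly (divisor n)) = 1"
    by (simp only: cpoly_divisor lead_coeff_mult lead_coeff_prod)
      (simp add: lead_coeff_comp lead_coeff_complex_cyclotomic)
  then show ?thesis by (simp add: degree_cpoly coeff_map_poly)
qed

text \<open>For odd d, Phi_d(q) divides Phi_d(q^2), so the whole divisor divides the product of all
  Phi_d(q^2) with d dividing n. That product is q^(2n) - 1, which has no repeated roots.\<close>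

lemma rsquarefree_divisor:
  assumes "n > 0"
  shows "rsquarefree (cpoly (divisor n))"
proof -
  let ?S = "\<lambda>p. pcompose p [:0, 0, 1:]"
  have fin: "finite {d. d dvd n \<and> P d}" for P using assms by auto
  have dvd: "complex_cyclotomic d dvd ?S (complex_cyclotomic d)" if "odd d" for d
  proof (rule rsquarefree_dvd_if_roots)
    have d: "d > 0" using that by (auto intro: Nat.gr0I)
    then have "complex_cyclotomic d dvd monom 1 d - 1"
      unfolding prod_complex_cyclotomic[OF d, symmetric] by (intro dvd_prodI) auto
    then show "rsquarefree (complex_cyclotomic d)"
      by (rule rsquarefree_dvd) (rule rsquarefree_unity[OF d])
    \<comment> \<open>Squaring preserves the order of z because d is odd.\<close>
    show "poly (?S (complex_cyclotomic d)) z = 0" if "poly (complex_cyclotomic d) z = 0" for z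
      using that primitive_root_square[OF _ \<open>odd d\<close>, of z]
      by (simp add: poly_pcompose poly_complex_cyclotomic_eq_0_iff[OF d] power2_eq_square)
  qed
  have "(\<Prod>d | d dvd n \<and> d > 1 \<and> odd d. complex_cyclotomic d) dvd
      (\<Prod>d | d dvd n \<and> d > 1 \<and> odd d. ?S (complex_cyclotomic d))"
    by (intro prod_dvd_prod) (auto intro: dvd)
  then have "cpoly (divisor n) dvd (\<Prod>d | d dvd n \<and> d > 1 \<and> odd d. ?S (complex_cyclotomic d)) *
     (\<Prod>d | d dvd n \<and> d > 1 \<and> even d. ?S (complex_cyclotomic d))"
    unfolding cpoly_divisor by (rule mult_dvd_mono) simp
  also have "\<dots> = (\<Prod>d | d dvd n \<and> d > 1. ?S (complex_cyclotomic d))"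
    by (subst prod.union_disjoint[symmetric]) (auto simp: fin intro!: prod.cong)
  also have "\<dots> dvd (\<Prod>d | d dvd n. ?S (complex_cyclotomic d))"
    using assms by (intro prod_dvd_prod_subset) auto
  also have "\<dots> = ?S (monom 1 n - 1)"
    by (simp add: pcompose_prod flip: prod_complex_cyclotomic[OF assms])
  also have "\<dots> = monom 1 (2 * n) - 1"
    by (rule iffD1[OF poly_eq_poly_eq_iff], rule ext)
      (simp add: poly_pcompose poly_monom power_mult power2_eq_square)
  finally show ?thesis
    by (rule rsquarefree_dvd) (use assms in \<open>simp add: rsquarefree_unity\<close>)
qed

text \<open>The parities merge here: for odd d, z itself has order d, so z^d = 1 and z^2 has order
  d; for even d, z^2 has order d and z^d = -1.\<close>

lemma root_divisor:
  assumes "poly (cpoly (divisor n)) z = 0" "n > 0"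
  obtains d where "d dvd n" "d > 1" "primitive_root d (z\<^sup>2)" "z ^ d = - ((-1) ^ d)"
proof -
  have fin: "finite {d. d dvd n \<and> P d}" for P using assms by auto
  from assms(1) consider
      d where "d dvd n" "d > 1" "odd d" "poly (complex_cyclotomic d) z = 0"
    | d where "d dvd n" "d > 1" "even d" "poly (complex_cyclotomic d) (z\<^sup>2) = 0"
    by (auto simp: cpoly_divisor poly_prod poly_pcompose fin power2_eq_square)
  then show thesis
  proof cases
    case 1
    then have "primitive_root d z" by (simp add: poly_complex_cyclotomic_eq_0_iff)
    then show thesis using 1 that[of d] primitive_root_square[of d z]
      by (simp add: primitive_root_def)
  next
    case 2
    then have "primitive_root d (z\<^sup>2)" by (simp add: poly_complex_cyclotomic_eq_0_iff)
    then show thesis using 2 that[of d] power_eq_minus_1[of d z] by simp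
  qed
qed

section \<open>Divisibility\<close>

theorem theorem2:
  fixes \<alpha> m n r :: nat
  assumes "\<alpha> > 0" and "m > 0" and "n > 0" and "r > 0"
  shows "dvd_in laurent_poly_ring
    [:(\<Prod>d | d dvd n \<and> d > 1 \<and> odd d. cyclotomic_at d qq) *
      (\<Prod>d | d dvd n \<and> d > 1 \<and> even d. cyclotomic_at d (qq\<^sup>2)):]
    (\<Sum>k=0..n-1. smult
       ((-1) ^ k * qint (qq\<^sup>2) (int (k * (k + 1))) ^ r * qint qq (int (2 * k + 1)) *
        qq ^ ((n - 1 - k) * (2 * \<alpha> * m + 1)))
       (w \<alpha> k (qq\<^sup>2) ^ m))"
proof -
  define D where "D = to_fract (divisor n)"
  define S where "S = (\<Sum>k<n. summand \<alpha> m n r qq k)"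
  have spec: "specializes z (coeff S i) (coeff (\<Sum>k<n. summand \<alpha> m n r z k) i)"
    if "z \<noteq> 0" "z\<^sup>2 \<noteq> 1" for z i
  proof -
    have "specializes_poly z S (\<Sum>k<n. summand \<alpha> m n r z k)"
      unfolding S_def by (intro specializes_poly_sum specializes_summand that)
    then show ?thesis by (simp add: specializes_poly_def that)
  qed
  have divisible: "coeff S i / D \<in> laurent_ring" for i
  proof -
    \<comment> \<open>The point 2 only serves to extract a Laurent representation; any z with z and
      z^2 - 1 nonzero would do.\<close>
    obtain p e where p: "coeff S i = to_fract p / qq ^ e"
      using specializes_laurent_ring[OF spec[of 2 i]] by (auto simp: laurent_ring_def)
    \<comment> \<open>Divisibility is shown over the complex numbers by checking roots; monicity of
      the divisor then makes the quotient integral.\<close>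
    have "cpoly (divisor n) dvd cpoly p"
    proof (rule rsquarefree_dvd_if_roots[OF rsquarefree_divisor[OF assms(3)]])
      fix z assume "poly (cpoly (divisor n)) z = 0"
      then obtain d where d: "d dvd n" "d > 1" "primitive_root d (z\<^sup>2)" "z ^ d = - ((-1) ^ d)"
        by (rule root_divisor[OF _ assms(3)])
      \<comment> \<open>Order d > 1 of z^2 rules out z^2 = 1, so the summands specialize at
        z.\<close>
      have z: "z \<noteq> 0" "z\<^sup>2 \<noteq> 1"
        using d(2,3) primitive_root_nonzero[OF d(3)] unfolding primitive_root_def
        by (auto, metis power_one_right nat_dvd_1_iff_1 less_irrefl One_nat_def)
      \<comment> \<open>By uniqueness p(z)/z^e is the i-th coefficient of the sum at z, which
        \<open>sum_summand_eq_0\<close> makes 0.\<close>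
      show "poly (cpoly p) z = 0"
        using specializes_unique[OF spec[OF z, of i, unfolded p] z(1)] z
        by (simp add: sum_summand_eq_0[OF d(3,4,1) assms(1,4)])
    qed
    then obtain C where "cpoly p = cpoly (divisor n) * C" by (auto simp: dvd_def)
    moreover from integral_quotient[OF this lead_coeff_divisor] obtain c where "cpoly c = C" ..
    ultimately have "p = divisor n * c" by (intro cpoly_inj) (simp add: cpoly_mult)
    moreover have "divisor n \<noteq> 0" using lead_coeff_divisor[of n] by auto
    ultimately have "coeff S i / D = to_fract c / qq ^ e" by (simp add: p D_def)
    then show ?thesis by (auto simp: laurent_ring_def)
  qed
  have D0: "D \<noteq> 0" using lead_coeff_divisor[of n] by (auto simp: D_def)
  have lr: "to_fract p \<in> laurent_ring" for p
    unfolding laurent_ring_def by (intro CollectI exI[of _ p] exI[of _ 0]) simp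
  have "(\<Sum>k=0..n-1. smult
       ((-1) ^ k * qint (qq\<^sup>2) (int (k * (k + 1))) ^ r * qint qq (int (2 * k + 1)) *
        qq ^ ((n - 1 - k) * (2 * \<alpha> * m + 1)))
       (w \<alpha> k (qq\<^sup>2) ^ m)) = S"
  proof -
    have "{0..n-1} = {..<n}" using assms by auto
    moreover have "w \<alpha> k (qq\<^sup>2) = w_gauss \<alpha> k (qq\<^sup>2)" for k
      by (rule w_eq_w_gauss) (simp_all add: qq_nonzero qq_square_power_neq_1)
    ultimately show ?thesis by (simp only: S_def summand_def)
  qed
  moreover have "[:D:] \<in> laurent_poly_ring"
    using lr[of 0] by (auto simp: laurent_poly_ring_def D_def lr coeff_pCons split: nat.split)
  moreover have "S \<in> laurent_poly_ring"
    using specializes_laurent_ring[OF spec[of 2]] by (simp add: laurent_poly_ring_def)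
  moreover have "smult (inverse D) S \<in> laurent_poly_ring"
    using divisible by (simp add: laurent_poly_ring_def divide_inverse mult.commute)
  moreover have "S = [:D:] * smult (inverse D) S" using D0 by simp
  ultimately show ?thesis
    unfolding dvd_in_def to_fract_divisor[symmetric] D_def[symmetric] by metis
qed

end
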